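(* Let $\rho\in\mathcal{P}(\Omega)$. For $\kappa\in(0,\infty)$, let $\nu_\kappa\in\mathcal{M}_+(\Omega)$ be a minimizer over $\mathcal{M}_+(\Omega)$ of $\nu\mapsto\int_\Omega\mathrm{HK}_\kappa^2(\delta_x,\nu)\,d\rho(x)$. Denote $$C_{\rho,\kappa}:=\sup_{y\in\Omega}\rho\big(B(y,\kappa\pi/2)\big).$$ Then $\|\nu_\kappa\|\le4\,C_{\rho,\kappa}$.
   Context: $\Omega \subset \mathbb{R}^d$ is a compact convex set with non-empty interior. $\mathcal{M}_+(\Omega)$ and $\mathcal{P}(\Omega)$ denote the non-negative Radon measures and probability measures on $\Omega$, $\|\mu\| = \mu(\Omega)$, and $B(y,r)$ is the open Euclidean ball (intersected with $\Omega$). For $\kappa\in(0,\infty)$ and $\mu,\nu\in\mathcal{M}_+(\Omega)$ the Hellinger--Kantorovich distance is $$\mathrm{HK}_\kappa^2(\mu,\nu) := \inf_{\gamma\in\mathcal{M}_+(\Omega\times\Omega)} \int \hat c_\kappa\,d\gamma + \mathrm{KL}(P_1\gamma|\mu)+\mathrm{KL}(P_2\gamma|\nu),$$ where $P_1\gamma,P_2\gamma$ are the two marginals of $\gamma$, $\hat c_\kappa(x,y) = -2\log\cos(|x-y|/\kappa)$ if $|x-y|\le\kappa\pi/2$ (with $-\log 0=+\infty$) and $+\infty$ otherwise, and $\mathrm{KL}(\mu|\nu)=\int\varphi(d\mu/d\nu)\,d\nu$ if $\mu\ll\nu$, $\mu\ge0$, and $+\infty$ otherwise, with $\varphi(s)=s\log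 s-s+1$ for $s>0$, $\varphi(0)=1$. With $\mathrm{Cos}(s):=\cos(\min\{|s|,\pi/2\})$ one has $\mathrm{HK}_\kappa^2(\delta_x,\nu)=1+\|\nu\|-2\sqrt{\int_\Omega\mathrm{Cos}^2(|x-y|/\kappa)\,d\nu(y)}$. *)

theory Defs
  imports "HOL-Probability.Probability"
begin

text \<open>
  Nonnegative Radon measures on \<open>S\<close>, used only for compact \<open>S\<close>: there they are precisely the
  finite Borel measures. The measure space carries the trace Borel algebra, so its space is \<open>S\<close>.
\<close>

definition nonneg_radon :: "'a::topological_space set \<Rightarrow> 'a measure set" where
  "nonneg_radon S = {\<mu>. sets \<mu> = sets (restrict_space borel S) \<and> finite_measure \<mu>}"

definition prob_radon :: "'a::topological_space set \<Rightarrow> 'a measure set" where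
  "prob_radon S = {\<mu> \<in> nonneg_radon S. prob_space \<mu>}"

definition dirac :: "'a::topological_space set \<Rightarrow> 'a \<Rightarrow> 'a measure" where
  "dirac S x = return (restrict_space borel S) x"

definition KL_entropy :: "real \<Rightarrow> real" where
  "KL_entropy s = (if s = 0 then 1 else s * ln s - s + 1)"

text \<open>
  The Kullback--Leibler divergence of \<open>\<mu>\<close> with respect to \<open>\<nu>\<close> for finite measures of arbitrary mass.
  The integrand is nonnegative, and the density is finite \<open>\<nu>\<close>-almost everywhere as \<open>\<mu>\<close> is finite.
  The library writes \<open>\<mu> \<lless> \<nu>\<close> as \<open>absolutely_continuous \<nu> \<mu>\<close>.
\<close>

definition KL :: "'a measure \<Rightarrow> 'a measure \<Rightarrow> ennreal" where
  "KL \<mu> \<nu> =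
    (if absolutely_continuous \<nu> \<mu>
     then \<integral>\<^sup>+ x. ennreal (KL_entropy (enn2real (RN_deriv \<nu> \<mu> x))) \<partial>\<nu>
     else \<infinity>)"

text \<open>
  The inequality is strict because the cost at distance \<open>\<kappa> * pi / 2\<close> is \<open>-2 log 0 = \<infinity>\<close>,
  whereas \<open>ln 0 = 0\<close> in the library.
\<close>

definition HK_cost :: "real \<Rightarrow> 'a::euclidean_space \<Rightarrow> 'a \<Rightarrow> ennreal" where
  "HK_cost \<kappa> x y =
    (if norm (x - y) < \<kappa> * pi / 2 then ennreal (- 2 * ln (cos (norm (x - y) / \<kappa>))) else \<infinity>)"

definition HK_sq ::
    "'a::euclidean_space set \<Rightarrow> real \<Rightarrow> 'a measure \<Rightarrow> 'a measure \<Rightarrow> ennreal" where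
  "HK_sq S \<kappa> \<mu> \<nu> =
    (INF \<gamma> \<in> nonneg_radon (S \<times> S).
       (\<integral>\<^sup>+ (x, y). HK_cost \<kappa> x y \<partial>\<gamma>)
       + KL (distr \<gamma> (restrict_space borel S) fst) \<mu>
       + KL (distr \<gamma> (restrict_space borel S) snd) \<nu>)"

definition HK_objective ::
    "'a::euclidean_space set \<Rightarrow> real \<Rightarrow> 'a measure \<Rightarrow> 'a measure \<Rightarrow> ennreal" where
  "HK_objective S \<kappa> \<rho> \<nu> = (\<integral>\<^sup>+ x. HK_sq S \<kappa> (dirac S x) \<nu> \<partial>\<rho>)"

definition ball_concentration :: "'a::euclidean_space set \<Rightarrow> real \<Rightarrow> 'a measure \<Rightarrow> real" where
  "ball_concentration S \<kappa> \<rho> = (SUP y \<in> S. measure \<rho> (ball y (\<kappa> * pi / 2) \<inter> S))"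

end

theory Submission
  imports Defs
begin

text \<open>
  By duality, \<open>HK\<^sup>2(\<delta>\<^sub>x, \<nu>) \<ge> 1 + \<parallel>\<nu>\<parallel> - b - (1/b) \<integral> Cos\<^sup>2(|x - y|/\<kappa>) d\<nu>(y)\<close> for every \<open>b > 0\<close>, the exact
  formula being the supremum over \<open>b\<close>. Only this bound and a comparison of \<open>\<nu>\<close> with the zero
  measure, whose objective is at most \<open>1\<close>, are needed: integrating over \<open>\<rho>\<close> and exchanging the
  integrals gives \<open>\<parallel>\<nu>\<parallel> \<le> b + C \<parallel>\<nu>\<parallel> / b\<close>, and \<open>b = \<parallel>\<nu>\<parallel> / 2\<close> yields the claim.
\<close>

section \<open>Convex duality for the entropy\<close>

lemma entropy_young:
  fixes s a :: real
  assumes "0 < s" "0 < a"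
  shows "s * ln a + s - a \<le> s * ln s"
proof -
  have "ln (a / s) \<le> a / s - 1"
    using assms by (intro ln_le_minus_one) simp
  then have "s * ln (a / s) \<le> s * (a / s - 1)"
    using assms by (intro mult_left_mono) auto
  then show ?thesis
    using assms by (simp add: ln_div algebra_simps)
qed

text \<open>Fenchel-Young inequality with dual variable \<open>ln a\<close>: the convex conjugate of
  \<open>KL_entropy\<close> is u \<mapsto> exp u - 1, and writing \<open>a\<close> for exp u lets
  later choices of \<open>a\<close> contain a cosine directly. Equality holds at
  \<open>s = a\<close>.\<close>

lemma KL_entropy_young:
  assumes "0 \<le> s" "0 < a"
  shows "1 + s * ln a \<le> KL_entropy s + a"
  using entropy_young[of s a] assms by (cases "s = 0") (auto simp: KL_entropy_def)

lemma KL_entropy_nonneg: "0 \<le> s \<Longrightarrow> 0 \<le> KL_entropy s"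
  using KL_entropy_young[of s 1] by simp

lemma borel_measurable_KL_entropy [measurable]: "KL_entropy \<in> borel_measurable borel"
  unfolding KL_entropy_def by measurable

text \<open>The pointwise hypothesis is integrated against \<nu> with \<open>s\<close> the density
  of \<mu>, which turns the terms carrying \<open>s\<close> into integrals against \<mu>. The dual
  potential is q - p, kept as two nonnegative functions because \<open>ennreal\<close> has no
  negative values; this also allows \<open>p\<close> to be infinite. Without absolute continuity the
  right-hand side is infinite.\<close>

lemma KL_lower_bound:
  assumes \<nu>: "sigma_finite_measure \<nu>" and \<mu>: "finite_measure \<mu>" and sets: "sets \<mu> = sets \<nu>"
    and [measurable]: "h \<in> borel_measurable \<nu>" "p \<in> borel_measurable \<nu>" "q \<in> borel_measurable \<nu>"
    and le: "\<And>y s. y \<in> space \<nu> \<Longrightarrow> 0 \<le> s \<Longrightarrow>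
      1 + ennreal s * q y \<le> ennreal (KL_entropy s) + h y + ennreal s * p y"
  shows "emeasure \<nu> (space \<nu>) + (\<integral>\<^sup>+ y. q y \<partial>\<mu>) \<le> KL \<mu> \<nu> + (\<integral>\<^sup>+ y. h y \<partial>\<nu>) + (\<integral>\<^sup>+ y. p y \<partial>\<mu>)"
proof (cases "absolutely_continuous \<nu> \<mu>")
  case True
  interpret \<nu>: sigma_finite_measure \<nu> by fact
  interpret \<mu>: finite_measure \<mu> by fact
  let ?s = "RN_deriv \<nu> \<mu>"
  have dens: "density \<nu> ?s = \<mu>"
    using True sets by (rule \<nu>.density_RN_deriv)
  have int_\<mu>: "(\<integral>\<^sup>+ y. f y \<partial>\<mu>) = (\<integral>\<^sup>+ y. ?s y * f y \<partial>\<nu>)" if "f \<in> borel_measurable \<nu>" for f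
    using that by (subst dens[symmetric]) (simp add: nn_integral_density)
  \<comment> \<open>The pointwise hypothesis speaks of real \<open>s\<close>, so it applies only
    where the density is finite.\<close>
  have fin: "AE y in \<nu>. ?s y \<noteq> \<infinity>"
    using \<mu>.sigma_finite_measure_axioms True sets by (rule \<nu>.RN_deriv_finite)
  have "emeasure \<nu> (space \<nu>) + (\<integral>\<^sup>+ y. q y \<partial>\<mu>) = (\<integral>\<^sup>+ y. 1 + ?s y * q y \<partial>\<nu>)"
    by (simp add: int_\<mu> nn_integral_add)
  also have "\<dots> \<le> (\<integral>\<^sup>+ y. ennreal (KL_entropy (enn2real (?s y))) + h y + ?s y * p y \<partial>\<nu>)"
  proof (rule nn_integral_mono_AE)
    show "AE y in \<nu>. 1 + ?s y * q y \<le> ennreal (KL_entropy (enn2real (?s y))) + h y + ?s y * p y"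
      using fin
    proof (rule AE_mp, intro AE_I2 impI)
      fix y assume "y \<in> space \<nu>" "?s y \<noteq> \<infinity>"
      then show "1 + ?s y * q y \<le> ennreal (KL_entropy (enn2real (?s y))) + h y + ?s y * p y"
        using le[of y "enn2real (?s y)"] by (simp add: less_top)
    qed
  qed
  also have "\<dots> = KL \<mu> \<nu> + (\<integral>\<^sup>+ y. h y \<partial>\<nu>) + (\<integral>\<^sup>+ y. p y \<partial>\<mu>)"
    using True by (simp add: KL_def int_\<mu> nn_integral_add)
  finally show ?thesis .
qed (simp add: KL_def)

text \<open>The density of the zero measure is 0 almost everywhere and
  \<open>KL_entropy 0 = 1\<close>, so the divergence integrates the constant 1.\<close>

lemma KL_null_le:
  assumes \<nu>: "sigma_finite_measure \<nu>" and sets: "sets \<mu> = sets \<nu>"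
    and null: "emeasure \<mu> (space \<mu>) = 0"
  shows "KL \<mu> \<nu> \<le> emeasure \<nu> (space \<nu>)"
proof -
  interpret \<nu>: sigma_finite_measure \<nu> by fact
  have zero: "emeasure \<mu> A = 0" if "A \<in> sets \<mu>" for A
    using null emeasure_mono[OF sets.sets_into_space[OF that], of \<mu>] by simp
  have ac: "absolutely_continuous \<nu> \<mu>"
    by (auto simp: absolutely_continuous_def null_sets_def sets zero)
  have "density \<nu> (\<lambda>_. 0) = \<mu>"
    by (rule measure_eqI) (auto simp: sets emeasure_density zero)
  then have "AE y in \<nu>. 0 = RN_deriv \<nu> \<mu> y"
    by (intro \<nu>.RN_deriv_unique) auto
  then have "(\<integral>\<^sup>+ y. ennreal (KL_entropy (enn2real (RN_deriv \<nu> \<mu> y))) \<partial>\<nu>) = (\<integral>\<^sup>+ y. 1 \<partial>\<nu>)"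
    by (intro nn_integral_cong_AE) (auto simp: KL_entropy_def)
  with ac show ?thesis
    by (simp add: KL_def)
qed

section \<open>The dual inequality for the transport cost\<close>

definition Cos_sq :: "real \<Rightarrow> 'a::euclidean_space \<Rightarrow> 'a \<Rightarrow> ennreal" where
  "Cos_sq \<kappa> x y =
    (if norm (x - y) < \<kappa> * pi / 2 then ennreal ((cos (norm (x - y) / \<kappa>))\<^sup>2) else 0)"

text \<open>Within range this is \<open>KL_entropy_young\<close> at a = cos^2 / b, for which ln a is
  minus the cost minus \<open>ln b\<close>. The terms \<open>ennreal (ln b)\<close> and
  \<open>ennreal (- ln b)\<close> are the positive and negative parts of \<open>ln b\<close>, placed
  on opposite sides to match the form of \<open>KL_lower_bound\<close>.\<close>

lemma HK_cost_young:
  assumes "0 < \<kappa>" "0 < b" "0 \<le> s"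
  shows "1 + ennreal s * ennreal (- ln b)
    \<le> ennreal (KL_entropy s) + Cos_sq \<kappa> x y * ennreal (1 / b)
      + ennreal s * (HK_cost \<kappa> x y + ennreal (ln b))"
proof (cases "norm (x - y) < \<kappa> * pi / 2")
  case True
  define c where "c = cos (norm (x - y) / \<kappa>)"
  have "norm (x - y) / \<kappa> < pi / 2"
    using True \<open>0 < \<kappa>\<close> by (subst pos_divide_less_eq) (auto simp: mult.commute)
  moreover have "- (pi / 2) < norm (x - y) / \<kappa>"
    by (rule less_le_trans[of _ 0]) (use \<open>0 < \<kappa>\<close> in auto)
  ultimately have "0 < c"
    unfolding c_def by (intro cos_gt_zero_pi)
  have "c \<le> 1"
    by (simp add: c_def)
  then have "ln c \<le> 0"
    using \<open>0 < c\<close> by simp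
  \<comment> \<open>\<open>max 0\<close> reproduces in the reals the truncation of negative numbers
    by \<open>ennreal\<close>.\<close>
  have real: "1 + s * max 0 (- ln b) \<le> KL_entropy s + c\<^sup>2 * (1 / b) + s * (- 2 * ln c + max 0 (ln b))"
  proof -
    have "1 + s * ln (c\<^sup>2 / b) \<le> KL_entropy s + c\<^sup>2 / b"
      using assms \<open>0 < c\<close> by (intro KL_entropy_young) auto
    moreover have "ln (c\<^sup>2 / b) = 2 * ln c - ln b"
      using assms \<open>0 < c\<close> by (simp add: ln_div ln_realpow)
    ultimately show ?thesis
      by (cases "0 \<le> ln b") (auto simp: algebra_simps)
  qed
  have "1 + ennreal s * ennreal (- ln b) = ennreal (1 + s * max 0 (- ln b))"
    using assms by (simp add: ennreal_mult)
  also have "\<dots> \<le> ennreal (KL_entropy s + c\<^sup>2 * (1 / b) + s * (- 2 * ln c + max 0 (ln b)))"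
    by (rule ennreal_leI[OF real])
  also have "\<dots> = ennreal (KL_entropy s) + ennreal (c\<^sup>2) * ennreal (1 / b)
      + ennreal s * (ennreal (- 2 * ln c) + ennreal (ln b))"
  proof -
    have "ennreal (c\<^sup>2 * (1 / b)) = ennreal (c\<^sup>2) * ennreal (1 / b)"
      using assms by (intro ennreal_mult) auto
    moreover have "ennreal (- 2 * ln c + max 0 (ln b)) = ennreal (- 2 * ln c) + ennreal (max 0 (ln b))"
      using \<open>ln c \<le> 0\<close> by (intro ennreal_plus) auto
    moreover have "ennreal (s * (- 2 * ln c + max 0 (ln b)))
        = ennreal s * ennreal (- 2 * ln c + max 0 (ln b))"
      using assms \<open>ln c \<le> 0\<close> by (intro ennreal_mult) auto
    moreover have "0 \<le> c\<^sup>2 * (1 / b)" "0 \<le> s * (- 2 * ln c + max 0 (ln b))"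
      using assms \<open>ln c \<le> 0\<close> by auto
    ultimately show ?thesis
      using KL_entropy_nonneg[OF assms(3)] by (simp only: ennreal_plus add_nonneg_nonneg ennreal_max_0)
  qed
  finally show ?thesis
    using True by (simp add: Cos_sq_def HK_cost_def c_def[symmetric])
next
  case False
  show ?thesis
  \<comment> \<open>Out of range the cost is infinite, which settles \<open>s > 0\<close>. For
    \<open>s = 0\<close> the product with the cost is 0, and \<open>KL_entropy 0 = 1\<close> gives
    the bound.\<close>
  proof (cases "s = 0")
    case True
    then show ?thesis by (simp add: KL_entropy_def)
  next
    case nz: False
    then show ?thesis
      using False assms by (simp add: HK_cost_def ennreal_mult_top)
  qed
qed

lemma borel_measurable_HK_cost [measurable (raw)]:
  assumes [measurable]: "f \<in> borel_measurable M" "g \<in> borel_measurable M"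
  shows "(\<lambda>z. HK_cost \<kappa> (f z) (g z)) \<in> borel_measurable M"
  unfolding HK_cost_def by measurable

lemma borel_measurable_Cos_sq [measurable (raw)]:
  assumes [measurable]: "f \<in> borel_measurable M" "g \<in> borel_measurable M"
  shows "(\<lambda>z. Cos_sq \<kappa> (f z) (g z)) \<in> borel_measurable M"
  unfolding Cos_sq_def by measurable

section \<open>Marginals of plans and the lower bound for the distance to a Dirac measure\<close>

lemma space_nonneg_radon: "\<mu> \<in> nonneg_radon S \<Longrightarrow> space \<mu> = S"
  unfolding nonneg_radon_def by (auto dest: sets_eq_imp_space_eq simp: space_restrict_space)

lemma nonneg_radon_borel_measurable_ident:
  "\<mu> \<in> nonneg_radon S \<Longrightarrow> (\<lambda>x. x) \<in> borel_measurable \<mu>"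
  unfolding nonneg_radon_def
  by (auto simp: measurable_restrict_space1 cong: measurable_cong_sets)

text \<open>A plan carries the trace of the Borel algebra of the product space, so measurability of
  the projections comes from their continuity.\<close>

lemma nonneg_radon_marginals:
  fixes S :: "'a::euclidean_space set"
  assumes "\<gamma> \<in> nonneg_radon (S \<times> S)"
  shows "fst \<in> measurable \<gamma> (restrict_space borel S)" "snd \<in> measurable \<gamma> (restrict_space borel S)"
proof -
  have cong: "measurable \<gamma> M = measurable (restrict_space borel (S \<times> S)) M" for M :: "'a measure"
    using assms by (intro measurable_cong_sets) (auto simp: nonneg_radon_def)
  have "fst \<in> borel_measurable (borel :: ('a \<times> 'a) measure)"
    "snd \<in> borel_measurable (borel :: ('a \<times> 'a) measure)"
    by (auto intro!: borel_measurable_continuous_onI continuous_intros)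
  then show "fst \<in> measurable \<gamma> (restrict_space borel S)" "snd \<in> measurable \<gamma> (restrict_space borel S)"
    unfolding cong by (auto intro!: measurable_restrict_space3)
qed

text \<open>Weak duality with the constant potential ln b on the Dirac side and -(cost + ln b) on
  the other. Both marginals of a plan have the same mass \<open>t\<close>, so the contributions t ln
  b cancel when the two entropy bounds are added.\<close>

lemma HK_sq_dirac_lower_bound:
  fixes S :: "'a::euclidean_space set"
  assumes \<nu>: "\<nu> \<in> nonneg_radon S" and x: "x \<in> S" and pos: "0 < \<kappa>" "0 < b"
  shows "1 + emeasure \<nu> S
    \<le> HK_sq S \<kappa> (dirac S x) \<nu> + (ennreal b + (\<integral>\<^sup>+ y. Cos_sq \<kappa> x y \<partial>\<nu>) * ennreal (1 / b))"
proof -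
  have sets\<nu>: "sets \<nu> = sets (restrict_space borel S)" and fin\<nu>: "finite_measure \<nu>"
    using \<nu> by (auto simp: nonneg_radon_def)
  have [measurable]: "(\<lambda>y. y) \<in> borel_measurable \<nu>"
    by (rule nonneg_radon_borel_measurable_ident[OF \<nu>])
  have space_S: "space (restrict_space borel S) = S"
    by (simp add: space_restrict_space)
  define D where "D = dirac S x"
  have D_sets: "sets D = sets (restrict_space borel S)" and space_D: "space D = S"
    by (auto simp: D_def dirac_def space_S)
  interpret D: prob_space D
    unfolding D_def dirac_def using x by (intro prob_space_return) (simp add: space_S)
  let ?R = "ennreal b + (\<integral>\<^sup>+ y. Cos_sq \<kappa> x y \<partial>\<nu>) * ennreal (1 / b)"
  have main: "1 + emeasure \<nu> S \<le> (\<integral>\<^sup>+ (x, y). HK_cost \<kappa> x y \<partial>\<gamma>)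
       + KL (distr \<gamma> (restrict_space borel S) fst) D
       + KL (distr \<gamma> (restrict_space borel S) snd) \<nu> + ?R" (is "_ \<le> ?c + KL ?P1 D + KL ?P2 \<nu> + ?R")
    if \<gamma>: "\<gamma> \<in> nonneg_radon (S \<times> S)" for \<gamma>
  proof (cases "absolutely_continuous D ?P1")
    case True
    interpret \<gamma>: finite_measure \<gamma> using \<gamma> by (simp add: nonneg_radon_def)
    note marg [measurable] = nonneg_radon_marginals[OF \<gamma>]
    have space\<gamma>: "space \<gamma> = S \<times> S" by (rule space_nonneg_radon[OF \<gamma>])
    define t where "t = emeasure \<gamma> (space \<gamma>)"
    have t: "t < \<infinity>" by (simp add: t_def less_top[symmetric])
    have mass: "emeasure (distr \<gamma> M f) (space (distr \<gamma> M f)) = t" if f: "f \<in> measurable \<gamma> M"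
      for f and M :: "'a measure"
    proof -
      have "f -` space M \<inter> space \<gamma> = space \<gamma>"
        using measurable_space[OF f] by auto
      then show ?thesis
        using emeasure_distr[OF f sets.top] by (simp add: t_def)
    qed
    note P1_mass = mass[OF marg(1)] and P2_mass = mass[OF marg(2)]
    have finP: "finite_measure ?P1" "finite_measure ?P2"
      by (auto intro!: \<gamma>.finite_measure_distr)
    \<comment> \<open>Absolute continuity with respect to the Dirac measure concentrates the plan on
      {x} \<times> S. The cost then depends on the second coordinate alone and can be integrated
      against the second marginal.\<close>
    have "S - {x} \<in> sets (restrict_space borel S)"
      by (auto simp: sets_restrict_space)
    then have "S - {x} \<in> null_sets D"
      by (auto simp: null_sets_def D_def dirac_def emeasure_return)
    then have "S - {x} \<in> null_sets ?P1"
      using True by (auto simp: absolutely_continuous_def)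
    then have "AE z in ?P1. z \<notin> S - {x}"
      by (rule AE_not_in)
    then have "AE z in \<gamma>. fst z \<notin> S - {x}"
      by (rule AE_distrD[OF marg(1)])
    then have AE_x: "AE z in \<gamma>. fst z = x"
      by (rule AE_mp) (auto intro!: AE_I2 simp: space\<gamma>)
    have "?c = (\<integral>\<^sup>+ z. HK_cost \<kappa> x (snd z) \<partial>\<gamma>)"
      using AE_x by (intro nn_integral_cong_AE) (auto simp: case_prod_unfold)
    also have "\<dots> = (\<integral>\<^sup>+ y. HK_cost \<kappa> x y \<partial>?P2)"
      using \<nu> sets\<nu>
      by (subst nn_integral_distr) (auto simp: cong: measurable_cong_sets intro!: measurable_restrict_space1)
    finally have c: "?c = (\<integral>\<^sup>+ y. HK_cost \<kappa> x y \<partial>?P2)" .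
    have cost_P2: "(\<lambda>y. HK_cost \<kappa> x y) \<in> borel_measurable ?P2"
      by (auto intro!: measurable_restrict_space1)

    \<comment> \<open>Signed form: 1 + t ln b \<le> KL + b.\<close>
    have 1: "1 + t * ennreal (ln b) \<le> KL ?P1 D + ennreal b + t * ennreal (- ln b)"
    proof -
      have "emeasure D (space D) + (\<integral>\<^sup>+ y. ennreal (ln b) \<partial>?P1)
          \<le> KL ?P1 D + (\<integral>\<^sup>+ y. ennreal b \<partial>D) + (\<integral>\<^sup>+ y. ennreal (- ln b) \<partial>?P1)"
      proof (rule KL_lower_bound)
        fix s :: real assume s: "0 \<le> s"
        have real: "1 + s * max 0 (ln b) \<le> KL_entropy s + b + s * max 0 (- ln b)"
          using KL_entropy_young[OF s \<open>0 < b\<close>] by (cases "0 \<le> ln b") (auto simp: max_def)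
        have "1 + ennreal s * ennreal (ln b) = ennreal (1 + s * max 0 (ln b))"
          using s by (simp add: ennreal_mult)
        also have "\<dots> \<le> ennreal (KL_entropy s + b + s * max 0 (- ln b))"
          by (rule ennreal_leI[OF real])
        also have "\<dots> = ennreal (KL_entropy s) + ennreal b + ennreal s * ennreal (- ln b)"
          using s pos KL_entropy_nonneg[OF s] by (simp add: ennreal_mult)
        finally show "1 + ennreal s * ennreal (ln b)
            \<le> ennreal (KL_entropy s) + ennreal b + ennreal s * ennreal (- ln b)" .
      qed (auto simp: D_sets finP D.sigma_finite_measure_axioms)
      then show ?thesis
        using P1_mass by (simp add: D.emeasure_space_1 mult.commute)
    qed
    \<comment> \<open>Signed form: the mass of \<nu> minus t ln b is at most KL plus the
      \<open>Cos_sq\<close> term plus the transport cost.\<close>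
    have 2: "emeasure \<nu> S + t * ennreal (- ln b)
      \<le> KL ?P2 \<nu> + (\<integral>\<^sup>+ y. Cos_sq \<kappa> x y \<partial>\<nu>) * ennreal (1 / b) + (?c + t * ennreal (ln b))"
    proof -
      have "emeasure \<nu> (space \<nu>) + (\<integral>\<^sup>+ y. ennreal (- ln b) \<partial>?P2)
          \<le> KL ?P2 \<nu> + (\<integral>\<^sup>+ y. Cos_sq \<kappa> x y * ennreal (1 / b) \<partial>\<nu>)
            + (\<integral>\<^sup>+ y. HK_cost \<kappa> x y + ennreal (ln b) \<partial>?P2)"
        using HK_cost_young[OF pos]
        by (intro KL_lower_bound)
          (auto simp: sets\<nu> finP fin\<nu> finite_measure.axioms(1) intro!: borel_measurable_Cos_sq borel_measurable_HK_cost)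
      also have "(\<integral>\<^sup>+ y. HK_cost \<kappa> x y + ennreal (ln b) \<partial>?P2) = ?c + t * ennreal (ln b)"
        using P2_mass cost_P2 by (subst nn_integral_add) (auto simp: c mult.commute)
      also have "(\<integral>\<^sup>+ y. Cos_sq \<kappa> x y * ennreal (1 / b) \<partial>\<nu>) = (\<integral>\<^sup>+ y. Cos_sq \<kappa> x y \<partial>\<nu>) * ennreal (1 / b)"
        by (intro nn_integral_multc) auto
      finally show ?thesis
        using P2_mass by (simp add: space_nonneg_radon[OF \<nu>] mult.commute)
    qed
    \<comment> \<open>\<open>?T\<close> is t |ln b|. It appears on both sides of the sum of the two
      estimates and may be cancelled because \<open>t\<close> is finite.\<close>
    let ?T = "t * ennreal (ln b) + t * ennreal (- ln b)"
    have "?T + (1 + emeasure \<nu> S) \<le> ?T + (?c + KL ?P1 D + KL ?P2 \<nu> + ?R)"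
      using add_mono[OF 1 2] by (simp add: ac_simps)
    moreover have "?T < top"
      using t by (simp add: ennreal_mult_less_top)
    ultimately show ?thesis
      by (auto simp: ennreal_add_left_cancel_le)
  qed (simp add: KL_def)
  \<comment> \<open>\<open>?R\<close> is moved to the left by truncated subtraction so that a bound
    for every plan passes to the infimum, and is then moved back.\<close>
  have "1 + emeasure \<nu> S - ?R \<le> HK_sq S \<kappa> D \<nu>"
    unfolding HK_sq_def
    by (rule INF_greatest) (use main finite_measure.emeasure_finite[OF fin\<nu>, of S] in \<open>simp add: ennreal_minus_le_iff add.commute\<close>)
  then show ?thesis
    by (simp add: ennreal_minus_le_iff D_def add.commute)
qed

section \<open>The zero measure as competitor\<close>

lemma null_measure_nonneg_radon: "null_measure (restrict_space borel S) \<in> nonneg_radon S"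
  by (auto simp: nonneg_radon_def intro!: finite_measureI)

text \<open>The zero plan has no transport cost, and by \<open>KL_null_le\<close> its entropy terms
  are at most the masses 1 and 0 of the two given measures.\<close>

lemma HK_sq_dirac_null_le:
  fixes S :: "'a::euclidean_space set"
  assumes "x \<in> S"
  shows "HK_sq S \<kappa> (dirac S x) (null_measure (restrict_space borel S)) \<le> 1"
proof -
  let ?\<gamma> = "null_measure (restrict_space borel (S \<times> S)) :: ('a \<times> 'a) measure"
  let ?B = "restrict_space borel S :: 'a measure"
  have \<gamma>: "?\<gamma> \<in> nonneg_radon (S \<times> S)"
    by (rule null_measure_nonneg_radon)
  have marg: "emeasure (distr ?\<gamma> ?B f) (space (distr ?\<gamma> ?B f)) = 0" if "f \<in> measurable ?\<gamma> ?B" for f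
    using that by (simp add: emeasure_distr)
  interpret D: prob_space "dirac S x"
    unfolding dirac_def using assms by (intro prob_space_return) (simp add: space_restrict_space)
  interpret N: finite_measure "null_measure ?B"
    by (auto intro!: finite_measureI)
  have "HK_sq S \<kappa> (dirac S x) (null_measure ?B)
      \<le> (\<integral>\<^sup>+ (x, y). HK_cost \<kappa> x y \<partial>?\<gamma>) + KL (distr ?\<gamma> ?B fst) (dirac S x)
        + KL (distr ?\<gamma> ?B snd) (null_measure ?B)"
    unfolding HK_sq_def by (rule INF_lower[OF \<gamma>])
  also have "\<dots> \<le> 0 + emeasure (dirac S x) (space (dirac S x))
      + emeasure (null_measure ?B) (space (null_measure ?B))"
    by (intro add_mono KL_null_le marg nonneg_radon_marginals[OF \<gamma>])
      (auto simp: dirac_def D.sigma_finite_measure_axioms[unfolded dirac_def] N.sigma_finite_measure_axioms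
        nn_integral_null_measure)
  finally show ?thesis
    by (simp add: D.emeasure_space_1)
qed

section \<open>Averaging over \<rho> and the mass bound\<close>

lemma Cos_sq_le_indicator: "Cos_sq \<kappa> x y \<le> indicator (ball y (\<kappa> * pi / 2)) x"
proof -
  have "(cos r)\<^sup>2 \<le> 1" for r :: real
    by (simp add: abs_square_le_1)
  then show ?thesis
    by (auto simp: Cos_sq_def dist_norm norm_minus_commute indicator_def split: if_splits)
qed

text \<open>Here \<open>y\<close> is fixed and the Dirac position \<open>x\<close> varies, so
  \<open>Cos_sq\<close> vanishes outside a ball about \<open>y\<close>. This is where the
  concentration of \<rho> enters.\<close>

lemma nn_integral_Cos_sq_le:
  assumes \<rho>: "\<rho> \<in> prob_radon S" and "y \<in> S"
  shows "(\<integral>\<^sup>+ x. Cos_sq \<kappa> x y \<partial>\<rho>) \<le> ennreal (ball_concentration S \<kappa> \<rho>)"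
proof -
  interpret prob_space \<rho> using \<rho> by (simp add: prob_radon_def)
  have sets: "sets \<rho> = sets (restrict_space borel S)" and space: "space \<rho> = S"
    using \<rho> by (auto simp: prob_radon_def nonneg_radon_def intro!: space_nonneg_radon)
  let ?B = "ball y (\<kappa> * pi / 2) \<inter> S"
  have B: "?B \<in> sets \<rho>"
    by (auto simp: sets sets_restrict_space)
  have "(\<integral>\<^sup>+ x. Cos_sq \<kappa> x y \<partial>\<rho>) \<le> (\<integral>\<^sup>+ x. indicator ?B x \<partial>\<rho>)"
    using Cos_sq_le_indicator[of \<kappa> _ y]
    by (intro nn_integral_mono) (simp add: space indicator_inter_arith)
  also have "\<dots> = ennreal (measure \<rho> ?B)"
    using B by (simp add: emeasure_eq_measure)
  also have "\<dots> \<le> ennreal (ball_concentration S \<kappa> \<rho>)"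
    unfolding ball_concentration_def using \<open>y \<in> S\<close>
    by (intro ennreal_leI cSUP_upper bdd_aboveI[of _ 1]) auto
  finally show ?thesis .
qed

text \<open>The bound for a Dirac measure is integrated with one \<open>b\<close> for all
  \<open>x\<close>. It is then linear in the \<open>Cos_sq\<close> integral, so Tonelli
  applies.\<close>

lemma HK_objective_lower_bound:
  fixes S :: "'a::euclidean_space set"
  assumes \<rho>: "\<rho> \<in> prob_radon S" and \<nu>: "\<nu> \<in> nonneg_radon S" and pos: "0 < \<kappa>" "0 < b"
  shows "1 + emeasure \<nu> S
    \<le> HK_objective S \<kappa> \<rho> \<nu> + (ennreal b + ennreal (ball_concentration S \<kappa> \<rho>) * emeasure \<nu> S * ennreal (1 / b))"
proof -
  interpret \<rho>: prob_space \<rho> using \<rho> by (simp add: prob_radon_def)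
  interpret \<nu>: finite_measure \<nu> using \<nu> by (simp add: nonneg_radon_def)
  interpret pair_sigma_finite \<rho> \<nu> ..
  have \<rho>': "\<rho> \<in> nonneg_radon S" using \<rho> by (simp add: prob_radon_def)
  note space = space_nonneg_radon[OF \<rho>'] space_nonneg_radon[OF \<nu>]
  have id [measurable]: "(\<lambda>x. x) \<in> borel_measurable \<rho>" "(\<lambda>x. x) \<in> borel_measurable \<nu>"
    using \<rho>' \<nu> by (auto intro: nonneg_radon_borel_measurable_ident)
  have "(\<lambda>z. Cos_sq \<kappa> (fst z) (snd z)) \<in> borel_measurable (\<rho> \<Otimes>\<^sub>M \<nu>)"
    using measurable_compose[OF measurable_fst id(1)] measurable_compose[OF measurable_snd id(2)]
    by (rule borel_measurable_Cos_sq)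
  then have joint [measurable]: "(\<lambda>(x, y). Cos_sq \<kappa> x y) \<in> borel_measurable (\<rho> \<Otimes>\<^sub>M \<nu>)"
    by (simp add: case_prod_unfold)
  define W where "W x = (\<integral>\<^sup>+ y. Cos_sq \<kappa> x y \<partial>\<nu>)" for x
  have [measurable]: "W \<in> borel_measurable \<rho>"
    unfolding W_def by measurable
  \<comment> \<open>Integrating in \<open>x\<close> first gives a bound uniform in \<open>y\<close>,
    which then multiplies the mass of \<nu>.\<close>
  have "(\<integral>\<^sup>+ x. W x \<partial>\<rho>) = (\<integral>\<^sup>+ y. \<integral>\<^sup>+ x. Cos_sq \<kappa> x y \<partial>\<rho> \<partial>\<nu>)"
    unfolding W_def by (rule Fubini'[symmetric]) (rule joint)
  also have "\<dots> \<le> (\<integral>\<^sup>+ y. ennreal (ball_concentration S \<kappa> \<rho>) \<partial>\<nu>)"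
    by (intro nn_integral_mono nn_integral_Cos_sq_le[OF \<rho>]) (simp add: space)
  finally have W: "(\<integral>\<^sup>+ x. W x \<partial>\<rho>) \<le> ennreal (ball_concentration S \<kappa> \<rho>) * emeasure \<nu> S"
    by (simp add: space)
  define h where "h x = ennreal b + W x * ennreal (1 / b)" for x
  have [measurable]: "h \<in> borel_measurable \<rho>"
    unfolding h_def by measurable
  have h: "(\<integral>\<^sup>+ x. h x \<partial>\<rho>) = ennreal b + (\<integral>\<^sup>+ x. W x \<partial>\<rho>) * ennreal (1 / b)"
    unfolding h_def by (simp add: nn_integral_add nn_integral_multc \<rho>.emeasure_space_1)
  \<comment> \<open>\<open>HK_sq\<close> is not known to be measurable in \<open>x\<close>, so the integral is split only after
    replacing it by the measurable minorant.\<close>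
  define g where "g x = 1 + emeasure \<nu> S - h x" for x
  have [measurable]: "g \<in> borel_measurable \<rho>"
    unfolding g_def by measurable
  have "1 + emeasure \<nu> S = (\<integral>\<^sup>+ x. 1 + emeasure \<nu> S \<partial>\<rho>)"
    by (simp add: \<rho>.emeasure_space_1)
  \<comment> \<open>Only an inequality holds, since the subtraction in \<open>g\<close> truncates at
    0 where \<open>h\<close> exceeds the constant.\<close>
  also have "\<dots> \<le> (\<integral>\<^sup>+ x. g x + h x \<partial>\<rho>)"
    by (intro nn_integral_mono) (metis g_def add.commute ennreal_minus_le_iff order_refl)
  also have "\<dots> = (\<integral>\<^sup>+ x. g x \<partial>\<rho>) + (\<integral>\<^sup>+ x. h x \<partial>\<rho>)"
    by (rule nn_integral_add) auto
  also have "(\<integral>\<^sup>+ x. g x \<partial>\<rho>) \<le> HK_objective S \<kappa> \<rho> \<nu>"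
    unfolding HK_objective_def
  proof (rule nn_integral_mono)
    fix x assume "x \<in> space \<rho>"
    then show "g x \<le> HK_sq S \<kappa> (dirac S x) \<nu>"
      using HK_sq_dirac_lower_bound[OF \<nu> _ pos, of x]
      by (simp add: g_def h_def W_def space ennreal_minus_le_iff add.commute)
  qed
  also have "(\<integral>\<^sup>+ x. h x \<partial>\<rho>)
      \<le> ennreal b + ennreal (ball_concentration S \<kappa> \<rho>) * emeasure \<nu> S * ennreal (1 / b)"
    unfolding h by (intro add_left_mono mult_right_mono W) auto
  finally show ?thesis
    by (simp add: add_left_mono add_right_mono)
qed

theorem lemma4p11:
  fixes \<Omega> :: "'a::euclidean_space set"
    and \<rho> \<nu> :: "'a measure"
    and \<kappa> :: real
  assumes "compact \<Omega>" and "convex \<Omega>" and "interior \<Omega> \<noteq> {}"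
    and "\<rho> \<in> prob_radon \<Omega>"
    and "0 < \<kappa>"
    and "is_arg_min (HK_objective \<Omega> \<kappa> \<rho>) (\<lambda>\<mu>. \<mu> \<in> nonneg_radon \<Omega>) \<nu>"
  shows "measure \<nu> \<Omega> \<le> 4 * ball_concentration \<Omega> \<kappa> \<rho>"
proof -
  interpret \<rho>: prob_space \<rho> using assms(4) by (simp add: prob_radon_def)
  have space\<rho>: "space \<rho> = \<Omega>"
    using assms(4) by (auto simp: prob_radon_def intro!: space_nonneg_radon)
  have \<nu>: "\<nu> \<in> nonneg_radon \<Omega>"
    using assms(6) by (simp add: is_arg_min_def)
  interpret \<nu>: finite_measure \<nu> using \<nu> by (simp add: nonneg_radon_def)
  define m where "m = measure \<nu> \<Omega>"
  define C where "C = ball_concentration \<Omega> \<kappa> \<rho>"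
  \<comment> \<open>The supremum in \<open>C\<close> is taken in the reals, so its sign is obtained
    from an actual point of \<Omega>; one exists because \<rho> has mass 1.\<close>
  have "\<Omega> \<noteq> {}"
    using \<rho>.not_empty space\<rho> by simp
  then have "0 \<le> C"
    unfolding C_def ball_concentration_def
    by (auto intro!: cSUP_upper2 bdd_aboveI[of _ 1] elim!: ex_in_conv[THEN iffD2, THEN exE])
  show ?thesis
  \<comment> \<open>The parameter b = m / 2 used below must be positive.\<close>
  proof (cases "m = 0")
    case True
    then show ?thesis using \<open>0 \<le> C\<close> by (simp add: m_def C_def)
  next
    case False
    then have "0 < m" by (simp add: m_def less_le)
    have "HK_objective \<Omega> \<kappa> \<rho> \<nu> \<le> HK_objective \<Omega> \<kappa> \<rho> (null_measure (restrict_space borel \<Omega>))"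
      using assms(6) null_measure_nonneg_radon by (auto simp: is_arg_min_def not_less)
    also have "\<dots> \<le> (\<integral>\<^sup>+ x. 1 \<partial>\<rho>)"
      unfolding HK_objective_def by (intro nn_integral_mono HK_sq_dirac_null_le) (simp add: space\<rho>)
    also have "\<dots> = 1"
      by (simp add: \<rho>.emeasure_space_1)
    finally have "HK_objective \<Omega> \<kappa> \<rho> \<nu> \<le> 1" .
    \<comment> \<open>With b = \<lambda> m and 0 < \<lambda> < 1, the inequality m \<le> b + C m / b
      becomes m \<le> C / (\<lambda> (1 - \<lambda>)). The choice \<lambda> = 1/2 minimizes the
      constant and gives 4.\<close>
    have "1 + ennreal m
        \<le> HK_objective \<Omega> \<kappa> \<rho> \<nu> + (ennreal (m / 2) + ennreal C * ennreal m * ennreal (1 / (m / 2)))"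
      using HK_objective_lower_bound[OF assms(4) \<nu> assms(5), of "m / 2"] \<open>0 < m\<close>
      by (simp only: \<nu>.emeasure_eq_measure m_def C_def half_gt_zero)
    also have "\<dots> \<le> 1 + (ennreal (m / 2) + ennreal C * ennreal m * ennreal (1 / (m / 2)))"
      by (rule add_right_mono) fact
    also have "\<dots> = ennreal (1 + (m / 2 + C * m * (1 / (m / 2))))"
      using \<open>0 < m\<close> \<open>0 \<le> C\<close>
      by (simp add: ennreal_mult[symmetric] ennreal_plus[symmetric] ennreal_1[symmetric]
        del: ennreal_plus ennreal_1)
    finally have "ennreal (1 + m) \<le> ennreal (1 + (m / 2 + 2 * C))"
      using \<open>0 < m\<close> by (simp add: mult.commute)
    then have "m \<le> m / 2 + 2 * C"
      using \<open>0 < m\<close> \<open>0 \<le> C\<close> by (subst (asm) ennreal_le_iff) auto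
    then show ?thesis by (simp add: m_def C_def)
  qed
qed

end
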